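(* Let $G$ be a graph such that $L_G^c=G[V(G)\setminus L(G)]$ is an almost-bipartite matching covered graph. Then $\mathrm{corona}(G)\cup N(\mathrm{core}(G))=V(G)$.
   Context: All graphs are finite, undirected and simple. $\alpha(G)$ is the maximum cardinality of an independent set of $G$, $\mu(G)$ the maximum cardinality of a matching, and $n(G)=|V(G)|$. $\Omega(G)$ is the set of maximum (i.e. maximum-cardinality) independent sets of $G$; $\mathrm{core}(G)=\bigcap_{S\in\Omega(G)}S$ and $\mathrm{corona}(G)=\bigcup_{S\in\Omega(G)}S$. For $X\subseteq V(G)$, $N(X)=\bigcup_{v\in X}N(v)$ is the neighborhood of $X$ in $G$, and $d_G(X)=|X|-|N(X)|$. An independent set $X$ (possibly empty) is a critical independent set if $d_G(X)$ is maximum over all independent sets of $G$ (this maximum equals $\max_{X\subseteq V(G)}d_G(X)$); a maximum critical independent set is a critical independent set of maximum cardinality. A K\H{o}nig--Egerv\'ary graph is a graph with $\alpha(G)+\mu(G)=n(G)$. Larson's decomposition (known theorem defining $L(G)$): for any graph $G$ there is a unique set $L(G)\subseteq V(G)$ such that (1) $\alpha(G)=\alpha(G[L(G)])+\alpha(G[V(G)\setminus L(G)])$; (2) $G[L(G)]$ is a K\H{o}nig--Egerv\'ary graph; (3) for every non-empty independent set $I$ in the graph $G[V(G)\setminus L(G)]$, $|N(I)|>|I|$, with the neighborhood taken in $G[V(G)\setminus L(G)]$; (4) for every maximum critical independent set $J$ of $G$, $L(G)=J\cup N(J)$. Adding an ear to a graph $H$: take two vertices $u,v$ of $H$ and add a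 path from $u$ to $v$ all of whose vertices other than $u,v$ are new; the length of the ear is its number of edges. A graph $G$ is an almost-bipartite matching covered graph if there is a sequence of graphs $G_1,G_2,\dots,G_r,G_{r+1}=G$ such that $G_1=K_2$; $G_i$ is obtained from $G_{i-1}$ by adding an ear of odd length for $i=2,\dots,r$; $G_r$ is bipartite (and hence matching covered); and $G_{r+1}=G$ is obtained from $G_r$ by adding an ear $P$ of even length with $V(P)\cap V(G_r)=V(G_1)$ (so the ends of $P$ are the two vertices of $G_1$). A bipartite matching covered graph is a connected bipartite graph in which every edge belongs to a perfect matching. *)

theory Defs
  imports "HOL-Library.Ramsey"
begin

datatype 'a graph = Graph (verts: "'a set") (edges: "'a set set")

definition simple_graph :: "'a graph \<Rightarrow> bool" where
  "simple_graph G \<longleftrightarrow> finite (verts G) \<and> edges G \<subseteq> [verts G]\<^bsup>2\<^esup>"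

definition induced :: "'a graph \<Rightarrow> 'a set \<Rightarrow> 'a graph" where
  "induced G X = Graph X {e \<in> edges G. e \<subseteq> X}"

definition neighbours :: "'a graph \<Rightarrow> 'a \<Rightarrow> 'a set" where
  "neighbours G v = {u. {u, v} \<in> edges G}"

definition nbhd :: "'a graph \<Rightarrow> 'a set \<Rightarrow> 'a set" where
  "nbhd G X = (\<Union>v\<in>X. neighbours G v)"

definition independent :: "'a graph \<Rightarrow> 'a set \<Rightarrow> bool" where
  "independent G S \<longleftrightarrow> S \<subseteq> verts G \<and> indep S (edges G)"

definition matching :: "'a graph \<Rightarrow> 'a set set \<Rightarrow> bool" where
  "matching G M \<longleftrightarrow> M \<subseteq> edges G \<and> pairwise disjnt M"

definition indep_num :: "'a graph \<Rightarrow> nat" where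
  "indep_num G = Max {card S | S. independent G S}"

definition matching_num :: "'a graph \<Rightarrow> nat" where
  "matching_num G = Max {card M | M. matching G M}"

definition max_indep_sets :: "'a graph \<Rightarrow> 'a set set" where
  "max_indep_sets G = {S. independent G S \<and> card S = indep_num G}"

definition core :: "'a graph \<Rightarrow> 'a set" where
  "core G = \<Inter> (max_indep_sets G)"

definition corona :: "'a graph \<Rightarrow> 'a set" where
  "corona G = \<Union> (max_indep_sets G)"

definition koenig_egervary :: "'a graph \<Rightarrow> bool" where
  "koenig_egervary G \<longleftrightarrow> indep_num G + matching_num G = card (verts G)"

definition difference :: "'a graph \<Rightarrow> 'a set \<Rightarrow> int" where
  "difference G X = int (card X) - int (card (nbhd G X))"

definition critical_indep :: "'a graph \<Rightarrow> 'a set \<Rightarrow> bool" where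
  "critical_indep G X \<longleftrightarrow>
     independent G X \<and> (\<forall>Y. independent G Y \<longrightarrow> difference G Y \<le> difference G X)"

definition max_critical_indep :: "'a graph \<Rightarrow> 'a set \<Rightarrow> bool" where
  "max_critical_indep G J \<longleftrightarrow>
     critical_indep G J \<and> (\<forall>X. critical_indep G X \<longrightarrow> card X \<le> card J)"

definition larson_decomposition :: "'a graph \<Rightarrow> 'a set \<Rightarrow> bool" where
  "larson_decomposition G L \<longleftrightarrow>
     L \<subseteq> verts G \<and>
     indep_num G = indep_num (induced G L) + indep_num (induced G (verts G - L)) \<and>
     koenig_egervary (induced G L) \<and>
     (\<forall>I. independent (induced G (verts G - L)) I \<and> I \<noteq> {} \<longrightarrow>
        card (nbhd (induced G (verts G - L)) I) > card I) \<and>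
     (\<forall>J. max_critical_indep G J \<longrightarrow> L = J \<union> nbhd G J)"

(* Larson's theorem: for every finite simple graph the description is uniquely satisfied. *)
definition larson_set :: "'a graph \<Rightarrow> 'a set" where
  "larson_set G = (THE L. larson_decomposition G L)"

definition larson_complement :: "'a graph \<Rightarrow> 'a graph" where
  "larson_complement G = induced G (verts G - larson_set G)"

definition is_K2 :: "'a graph \<Rightarrow> bool" where
  "is_K2 G \<longleftrightarrow> (\<exists>u v. u \<noteq> v \<and> G = Graph {u, v} {{u, v}})"

definition bipartite :: "'a graph \<Rightarrow> bool" where
  "bipartite G \<longleftrightarrow> (\<exists>A B. A \<union> B = verts G \<and> A \<inter> B = {} \<and>
     (\<forall>e\<in>edges G. \<exists>a\<in>A. \<exists>b\<in>B. e = {a, b}))"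

(* A path is given by the list of its successive vertices, ends included. *)
definition path_edges :: "'a list \<Rightarrow> 'a set set" where
  "path_edges p = {{p ! i, p ! Suc i} | i. Suc i < length p}"

definition path_length :: "'a list \<Rightarrow> nat" where
  "path_length p = length p - 1"

(* Since graphs are simple, an ear of length 1 must join two non-adjacent vertices of H;
   for longer ears the disjointness of the edge sets follows from the other conditions. *)
definition is_ear :: "'a graph \<Rightarrow> 'a list \<Rightarrow> bool" where
  "is_ear H p \<longleftrightarrow> length p \<ge> 2 \<and> distinct p \<and>
     hd p \<in> verts H \<and> last p \<in> verts H \<and> set (butlast (tl p)) \<inter> verts H = {} \<and>
     path_edges p \<inter> edges H = {}"

definition add_ear :: "'a graph \<Rightarrow> 'a list \<Rightarrow> 'a graph" where
  "add_ear H p = Graph (verts H \<union> set p) (edges H \<union> path_edges p)"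

(* Only the values Gs 1, ..., Gs (r + 1) of the sequence are relevant. *)
definition almost_bipartite_matching_covered :: "'a graph \<Rightarrow> bool" where
  "almost_bipartite_matching_covered G \<longleftrightarrow>
     (\<exists>(r::nat) (Gs :: nat \<Rightarrow> 'a graph).
        r \<ge> 1 \<and> is_K2 (Gs 1) \<and>
        (\<forall>i\<in>{2..r}. \<exists>p. is_ear (Gs (i - 1)) p \<and> odd (path_length p) \<and>
           Gs i = add_ear (Gs (i - 1)) p) \<and>
        bipartite (Gs r) \<and>
        (\<exists>P. is_ear (Gs r) P \<and> even (path_length P) \<and>
           set P \<inter> verts (Gs r) = verts (Gs 1) \<and> Gs (r + 1) = add_ear (Gs r) P) \<and>
        Gs (r + 1) = G)"

end

theory Submission
  imports Defs
begin

text \<open>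
  Let \<open>J\<close> be a maximum critical independent set of \<open>G\<close>, let \<open>L = J \<union> N(J)\<close> and let \<open>H\<close> be the subgraph
  induced by the vertices outside \<open>L\<close>. Three facts give the theorem.

  First, criticality of \<open>J\<close> is Hall's condition for a matching \<open>f\<close> of \<open>N(J)\<close> into \<open>J\<close>
  (\<open>critical_matching\<close>). It makes \<open>J\<close> a maximum independent set of \<open>G[L]\<close>. No edge joins
  \<open>J\<close> to \<open>H\<close>, so \<open>\<alpha>(G) = |J| + \<alpha>(H)\<close>: \<open>J\<close> together with any maximum independent set of \<open>H\<close> is
  maximum in \<open>G\<close>, and every maximum independent set \<open>S\<close> of \<open>G\<close> satisfies \<open>|S \<inter> L| = |J|\<close>. The set
  \<open>L\<close> is a Larson decomposition, and the fourth clause of that notion makes it the only one; hence it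
  is \<open>larson_set G\<close>, and \<open>H\<close> is \<open>larson_complement G\<close> (\<open>larson_set_eq\<close>). The clause requires all
  maximum critical independent sets to have the same closure; this follows from
  supermodularity of the difference function (\<open>max_critical_closure_subset\<close>).

  Secondly, if the corona of \<open>H\<close> is all of \<open>H\<close>, the conclusion holds for \<open>G\<close>. The vertices of \<open>J\<close>
  and of \<open>H\<close> are in the corona of \<open>G\<close>. Let \<open>v \<in> N(J)\<close>. Either its partner \<open>f v\<close> is in the core, and
  \<open>v\<close> is a neighbour of the core, or some maximum independent set \<open>S\<close> avoids \<open>f v\<close>. In the latter case
  \<open>|S \<inter> L| = |J|\<close> forces \<open>S\<close> to meet each pair \<open>{v, f v}\<close>, so \<open>v \<in> S\<close>
  (\<open>corona_core_if_complement_covered\<close>).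

  Thirdly, an almost-bipartite matching covered graph equals its corona. It consists of a bipartite
  graph \<open>K\<close> with colour classes \<open>A\<close> and \<open>B\<close>, having a perfect matching through an edge \<open>xy\<close>, and
  of a path from \<open>x\<close> to \<open>y\<close> with \<open>2k\<close> edges. Replacing \<open>xy\<close> in the perfect matching
  by alternate edges of the path leaves only \<open>x\<close>, or only \<open>y\<close>, uncovered. As no independent set
  contains both, \<open>\<alpha> \<le> |A| - 1 + k\<close>. The bound is attained by \<open>A\<close> and by \<open>B\<close>, each with
  the interior path vertices of even index, and by \<open>A - {x, y}\<close> with those of odd index; these
  sets cover the graph (\<open>corona_bipartite_even_ear\<close>).
\<close>

section \<open>Hall's theorem\<close>

text \<open>Induction on the size of \<open>X\<close>. If a proper non-empty subfamily is tight (its union has no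
  spare element), represent it first and delete its union from the remaining sets; tightness is what
  preserves the condition for them. If no such subfamily exists, any choice for one element removes
  at most one element from each other union, and there the inequality is strict.\<close>

lemma hall:
  fixes F :: "'b \<Rightarrow> 'c set"
  assumes "finite X" and "\<And>x. x \<in> X \<Longrightarrow> finite (F x)"
    and "\<And>Y. Y \<subseteq> X \<Longrightarrow> card Y \<le> card (\<Union>(F ` Y))"
  shows "\<exists>f. inj_on f X \<and> (\<forall>x\<in>X. f x \<in> F x)"
  using assms
proof (induction "card X" arbitrary: X F rule: less_induct)
  case less
  note fin = less.prems(1,2) and hall_cond = less.prems(3)
  have finU: "finite (\<Union>(F ` Y))" if "Y \<subseteq> X" for Y
    using that fin finite_subset by blast
  consider "X = {}"
    | (tight) Y where "Y \<noteq> {}" "Y \<subset> X" "card Y = card (\<Union>(F ` Y))"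
    | (loose) "X \<noteq> {}" "\<And>Y. Y \<noteq> {} \<Longrightarrow> Y \<subset> X \<Longrightarrow> card Y < card (\<Union>(F ` Y))"
    using hall_cond by (metis order_le_less psubset_imp_subset)
  then show ?case
  proof cases
    case 1
    then show ?thesis by simp
  next
    case tight
    let ?U = "\<Union>(F ` Y)"
    have "card Y < card X" using tight fin(1) psubset_card_mono by blast
    moreover have "finite Y" using tight(2) fin(1) finite_subset by blast
    ultimately have "\<exists>f. inj_on f Y \<and> (\<forall>y\<in>Y. f y \<in> F y)"
      using fin(2) hall_cond tight(2) by (intro less.hyps) auto
    then obtain f where f: "inj_on f Y" "\<And>y. y \<in> Y \<Longrightarrow> f y \<in> F y" by blast
    have "card (X - Y) < card X"
      using tight(1,2) fin(1) by (intro psubset_card_mono) auto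
    moreover have "card Z \<le> card (\<Union>((\<lambda>x. F x - ?U) ` Z))" if Z: "Z \<subseteq> X - Y" for Z
    proof -
      have "finite Z" using Z fin(1) finite_subset by blast
      then have "card Z + card Y = card (Z \<union> Y)"
        using Z \<open>finite Y\<close> by (intro card_Un_disjoint[symmetric]) auto
      also have "\<dots> \<le> card (\<Union>(F ` (Z \<union> Y)))"
        using Z tight(2) by (intro hall_cond) auto
      also have "\<Union>(F ` (Z \<union> Y)) = \<Union>((\<lambda>x. F x - ?U) ` Z) \<union> ?U" by auto
      also have "card \<dots> \<le> card (\<Union>((\<lambda>x. F x - ?U) ` Z)) + card ?U" by (rule card_Un_le)
      finally show ?thesis using tight(3) by linarith
    qed
    ultimately have "\<exists>g. inj_on g (X - Y) \<and> (\<forall>x\<in>X - Y. g x \<in> F x - ?U)"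
      using fin by (intro less.hyps) auto
    then obtain g where g: "inj_on g (X - Y)" "\<forall>x\<in>X - Y. g x \<in> F x - ?U"
      by (elim exE conjE)
    let ?h = "\<lambda>x. if x \<in> Y then f x else g x"
    have "f ` Y \<subseteq> ?U" "g ` (X - Y) \<subseteq> - ?U" using f(2) g(2) by fast+
    then have "f ` Y \<inter> g ` (X - Y) = {}" by blast
    with f(1) g(1) have "inj_on ?h (Y \<union> (X - Y))" by (rule inj_on_disjoint_Un)
    moreover have "Y \<union> (X - Y) = X" using tight(2) by auto
    ultimately have "inj_on ?h X" by simp
    moreover have "\<forall>x\<in>X. ?h x \<in> F x" using f g by auto
    ultimately show ?thesis by (intro exI[of _ ?h]) simp
  next
    case loose
    then obtain x where x: "x \<in> X" by auto
    have "F x \<noteq> {}" using hall_cond[of "{x}"] x by auto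
    then obtain y where y: "y \<in> F x" by auto
    have "card (X - {x}) < card X" using x fin(1) by (meson card_Diff1_less)
    moreover have "card Z \<le> card (\<Union>((\<lambda>z. F z - {y}) ` Z))" if Z: "Z \<subseteq> X - {x}" for Z
    proof (cases "Z = {}")
      case False
      have "card Z < card (\<Union>(F ` Z))" using loose(2)[of Z] False Z x by blast
      moreover have "\<Union>((\<lambda>z. F z - {y}) ` Z) = \<Union>(F ` Z) - {y}" by auto
      moreover have "card (\<Union>(F ` Z)) - 1 \<le> card (\<Union>(F ` Z) - {y})"
        by (simp add: card_Diff_singleton_if)
      ultimately show ?thesis by simp
    qed simp
    ultimately have "\<exists>g. inj_on g (X - {x}) \<and> (\<forall>z\<in>X - {x}. g z \<in> F z - {y})"
      using fin by (intro less.hyps) auto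
    then obtain g where g: "inj_on g (X - {x})" "\<forall>z\<in>X - {x}. g z \<in> F z - {y}"
      by (elim exE conjE)
    let ?h = "g(x := y)"
    have "inj_on ?h (X - {x})" using g(1) by (simp add: inj_on_def)
    moreover have "?h x \<notin> ?h ` (X - {x} - {x})" using g(2) by auto
    ultimately have "inj_on ?h (insert x (X - {x}))" unfolding inj_on_insert by blast
    then have "inj_on ?h X" using x by (simp add: insert_absorb)
    moreover have "\<forall>z\<in>X. ?h z \<in> F z" using g y by auto
    ultimately show ?thesis by blast
  qed
qed

section \<open>Independent sets, neighbourhoods and matchings\<close>

lemma edge_cases:
  assumes "simple_graph G" "e \<in> edges G"
  obtains u v where "e = {u, v}" "u \<noteq> v" "u \<in> verts G" "v \<in> verts G"
  using assms unfolding simple_graph_def by (meson nsets2_E subsetD)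

lemma edge_verts:
  assumes "simple_graph G" "{u, v} \<in> edges G"
  shows "u \<noteq> v" "u \<in> verts G" "v \<in> verts G"
  using assms subsetD[of "edges G" "[verts G]\<^bsup>2\<^esup>" "{u, v}"] unfolding simple_graph_def by auto

lemma simple_graph_induced:
  assumes "simple_graph G" "X \<subseteq> verts G"
  shows "simple_graph (induced G X)"
  using assms unfolding simple_graph_def induced_def nsets_def by (auto intro: finite_subset)

lemma independent_iff:
  assumes "simple_graph G"
  shows "independent G S \<longleftrightarrow> S \<subseteq> verts G \<and> (\<forall>e\<in>edges G. \<not> e \<subseteq> S)"
proof -
  have "(\<forall>v\<in>S. \<forall>w\<in>S. v \<noteq> w \<longrightarrow> {v, w} \<notin> edges G) \<longleftrightarrow> (\<forall>e\<in>edges G. \<not> e \<subseteq> S)"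
    using edge_cases[OF assms] by (metis empty_subsetI insert_subset)
  then show ?thesis by (simp add: independent_def indep_def)
qed

lemma independent_finite: "simple_graph G \<Longrightarrow> independent G S \<Longrightarrow> finite S"
  unfolding simple_graph_def independent_def using finite_subset by blast

lemma independent_subset: "independent G S \<Longrightarrow> T \<subseteq> S \<Longrightarrow> independent G T"
  unfolding independent_def indep_def by blast

lemma independent_edge:
  assumes "simple_graph G" "independent G S" "u \<in> S" "v \<in> S"
  shows "{u, v} \<notin> edges G"
  using assms by (meson independent_iff empty_subsetI insert_subset)

lemma independent_induced_iff:
  assumes "X \<subseteq> verts G"
  shows "independent (induced G X) S \<longleftrightarrow> independent G S \<and> S \<subseteq> X"
  using assms unfolding independent_def indep_def induced_def by (auto 0 3)

lemma nbhd_iff: "w \<in> nbhd G X \<longleftrightarrow> (\<exists>v\<in>X. {w, v} \<in> edges G)"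
  by (auto simp: nbhd_def neighbours_def)

lemma nbhdI:
  assumes "v \<in> X" "{v, w} \<in> edges G \<or> {w, v} \<in> edges G"
  shows "w \<in> nbhd G X"
  using assms by (auto simp: nbhd_iff insert_commute)

lemma nbhd_subset_verts: "simple_graph G \<Longrightarrow> nbhd G X \<subseteq> verts G"
  by (auto simp: nbhd_iff dest: edge_verts)

lemma independent_Un:
  assumes "independent G S" "independent G T" "T \<inter> nbhd G S = {}"
  shows "independent G (S \<union> T)"
proof -
  have cross: "{t, s} \<notin> edges G" "{s, t} \<notin> edges G" if "s \<in> S" "t \<in> T" for s t
    using assms(3) that insert_commute[of s t "{}"] by (auto simp: nbhd_iff disjoint_iff)
  have "{v, w} \<notin> edges G" if "v \<in> S \<union> T" "w \<in> S \<union> T" "v \<noteq> w" for v w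
    using that cross assms(1,2) unfolding independent_def indep_def by (elim UnE) simp_all
  then show ?thesis using assms(1,2) by (simp add: independent_def indep_def)
qed

lemma independent_nbhd_disjoint:
  "simple_graph G \<Longrightarrow> independent G S \<Longrightarrow> T \<subseteq> S \<Longrightarrow> S \<inter> nbhd G T = {}"
  by (auto simp: nbhd_iff) (metis independent_edge subsetD)

lemma indep_num_ge:
  assumes "simple_graph G" "independent G S"
  shows "card S \<le> indep_num G"
proof -
  have "{card S |S. independent G S} \<subseteq> card ` Pow (verts G)"
    unfolding independent_def by auto
  then have "finite {card S |S. independent G S}"
    using assms(1) unfolding simple_graph_def by (meson finite_Pow_iff finite_imageI finite_subset)
  then show ?thesis unfolding indep_num_def using assms(2) by (intro Max_ge) auto
qed

lemma indep_num_eqI: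
  assumes "simple_graph G" "independent G S" "card S = n"
    and "\<And>T. independent G T \<Longrightarrow> card T \<le> n"
  shows "indep_num G = n"
proof -
  have "{card S |S. independent G S} \<subseteq> {..n}" using assms(4) by auto
  then have "finite {card S |S. independent G S}" by (meson finite_atMost finite_subset)
  then show ?thesis unfolding indep_num_def using assms(2-4) by (intro Max_eqI) auto
qed

lemma max_indep_exists:
  assumes "simple_graph G"
  obtains S where "independent G S" "card S = indep_num G"
proof -
  have "independent G {}" by (simp add: independent_def indep_def)
  moreover have "\<forall>S. independent G S \<longrightarrow> card S < Suc (indep_num G)"
    using indep_num_ge[OF assms] by (simp add: less_Suc_eq_le)
  ultimately obtain S where S: "independent G S" "\<And>T. independent G T \<Longrightarrow> card T \<le> card S"
    using ex_has_greatest_nat[of "independent G" "{}" card "Suc (indep_num G)"] by auto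
  then have "indep_num G = card S" using indep_num_eqI[OF assms] by blast
  then show ?thesis using S that by simp
qed

text \<open>For a matching \<open>N\<close> this is the easy half of Koenig duality: a vertex cover is at least as
  large as a matching.\<close>

lemma card_le_transversal:
  assumes "pairwise disjnt N" "\<And>e. e \<in> N \<Longrightarrow> e \<inter> C \<noteq> {}" "finite C"
  shows "card N \<le> card C"
proof -
  have "\<forall>e\<in>N. \<exists>v. v \<in> e \<inter> C" using assms(2) by blast
  then obtain h where h: "\<And>e. e \<in> N \<Longrightarrow> h e \<in> e \<inter> C" by metis
  have "inj_on h N"
  proof (rule inj_onI)
    fix d e assume *: "d \<in> N" "e \<in> N" "h d = h e"
    then have "\<not> disjnt d e" using h[of d] h[of e] unfolding disjnt_def by auto
    then show "d = e" using assms(1) * unfolding pairwise_def by blast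
  qed
  moreover have "h ` N \<subseteq> C" using h by auto
  ultimately show ?thesis using assms(3) by (rule card_inj_on_le)
qed

text \<open>A set covered by \<open>m\<close> edges and containing none of them has at most \<open>m\<close> elements, as
  each edge accounts for at most one of them.\<close>

lemma card_le_if_no_pair_inside:
  assumes "finite N" "S \<subseteq> \<Union>N" "\<And>e. e \<in> N \<Longrightarrow> \<exists>u v. e = {u, v} \<and> \<not> e \<subseteq> S"
  shows "card S \<le> card N"
proof -
  have "\<forall>s\<in>S. \<exists>e. e \<in> N \<and> s \<in> e" using assms(2) by blast
  then obtain h where h: "\<And>s. s \<in> S \<Longrightarrow> h s \<in> N \<and> s \<in> h s" by metis
  have "inj_on h S"
  proof (rule inj_onI)
    fix s t assume *: "s \<in> S" "t \<in> S" "h s = h t"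
    obtain u v where "h s = {u, v}" "\<not> h s \<subseteq> S" using assms(3) h[OF *(1)] by blast
    then show "s = t" using h[OF *(1)] h[OF *(2)] * by auto
  qed
  moreover have "h ` S \<subseteq> N" using h by auto
  ultimately show ?thesis using assms(1) by (rule card_inj_on_le)
qed

lemma matching_num_eqI:
  assumes "matching G M" "card M = n" "\<And>N. matching G N \<Longrightarrow> card N \<le> n"
  shows "matching_num G = n"
proof -
  have "{card M |M. matching G M} \<subseteq> {..n}" using assms(3) by auto
  then have "finite {card M |M. matching G M}" by (meson finite_atMost finite_subset)
  then show ?thesis unfolding matching_num_def using assms by (intro Max_eqI) auto
qed

section \<open>Critical sets and Larson's decomposition\<close>

lemma max_critical_indep_exists:
  assumes "simple_graph G"
  shows "\<exists>J. max_critical_indep G J"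
proof -
  have fin: "finite {I. independent G I}"
    using assms unfolding simple_graph_def independent_def
    by (metis (no_types, lifting) Collect_mono_iff Pow_def finite_Pow_iff finite_subset)
  have "independent G {}" by (simp add: independent_def indep_def)
  then have ne: "{I. independent G I} \<noteq> {}" by auto
  let ?D = "difference G ` {I. independent G I}"
  have "finite ?D" "?D \<noteq> {}" using fin ne by auto
  then have "Max ?D \<in> ?D" by (rule Max_in)
  then obtain I where I: "independent G I" "difference G I = Max ?D" by auto
  have "difference G Y \<le> difference G I" if "independent G Y" for Y
    unfolding I(2) using that \<open>finite ?D\<close> by (intro Max_ge) auto
  then have "critical_indep G I" using I(1) unfolding critical_indep_def by blast
  moreover have "\<forall>X. critical_indep G X \<longrightarrow> card X < Suc (indep_num G)"
    using indep_num_ge[OF assms] unfolding critical_indep_def by (simp add: less_Suc_eq_le)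
  ultimately show ?thesis
    using ex_has_greatest_nat[of "critical_indep G" I card "Suc (indep_num G)"]
    unfolding max_critical_indep_def by auto
qed

text \<open>Arbitrary sets do no better than independent ones: discarding from \<open>X\<close> the vertices that have
  a neighbour in \<open>X\<close> leaves an independent set and removes at least as many vertices from the
  neighbourhood, since no remaining vertex is adjacent to \<open>X\<close>.\<close>

lemma difference_le_critical:
  assumes G: "simple_graph G" and J: "critical_indep G J" and X: "X \<subseteq> verts G"
  shows "difference G X \<le> difference G J"
proof -
  let ?I = "X - nbhd G X"
  have finV: "finite (verts G)" using G by (simp add: simple_graph_def)
  have fin: "finite X" "finite (nbhd G X)"
    using X finV nbhd_subset_verts[OF G] finite_subset by blast+
  have "independent G ?I"
    using X unfolding independent_def indep_def by (auto simp: nbhd_iff)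
  then have "difference G ?I \<le> difference G J" using J unfolding critical_indep_def by blast
  moreover have "nbhd G ?I \<subseteq> nbhd G X - X"
    by (auto simp: nbhd_iff) (metis insert_commute)
  then have "card (nbhd G ?I) \<le> card (nbhd G X - X)" using fin by (intro card_mono) auto
  moreover have "card (nbhd G X - X) + card (X \<inter> nbhd G X) = card (nbhd G X)"
    using fin by (metis Int_commute add.commute card_Int_Diff)
  moreover have "card ?I + card (X \<inter> nbhd G X) = card X"
    using fin by (metis add.commute card_Int_Diff)
  ultimately show ?thesis unfolding difference_def by linarith
qed

text \<open>Hall's condition for \<open>R \<subseteq> N(J)\<close>: removing from \<open>J\<close> all neighbours of \<open>R\<close> removes all of
  \<open>R\<close> from the neighbourhood of \<open>J\<close>. As this cannot increase the difference, \<open>R\<close> has at least \<open>|R|\<close>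
  neighbours in \<open>J\<close>.\<close>

lemma critical_matching:
  assumes G: "simple_graph G" and J: "critical_indep G J"
  obtains f where "inj_on f (nbhd G J)" "\<And>v. v \<in> nbhd G J \<Longrightarrow> f v \<in> J"
    "\<And>v. v \<in> nbhd G J \<Longrightarrow> {v, f v} \<in> edges G"
proof -
  have finV: "finite (verts G)" using G by (simp add: simple_graph_def)
  have JI: "independent G J" using J by (simp add: critical_indep_def)
  have finJ: "finite J" using independent_finite[OF G JI] .
  have finN: "finite (nbhd G J)" using finV nbhd_subset_verts[OF G] finite_subset by blast
  let ?F = "\<lambda>v. J \<inter> neighbours G v"
  have "\<exists>f. inj_on f (nbhd G J) \<and> (\<forall>v\<in>nbhd G J. f v \<in> ?F v)"
  proof (rule hall[OF finN])
    show "finite (?F v)" for v using finJ by simp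
    fix R assume R: "R \<subseteq> nbhd G J"
    let ?U = "\<Union>(?F ` R)"
    have U: "?U \<subseteq> J" by blast
    have "independent G (J - ?U)" using independent_subset[OF JI] by blast
    then have "difference G (J - ?U) \<le> difference G J" using J unfolding critical_indep_def by blast
    moreover have "nbhd G (J - ?U) \<subseteq> nbhd G J - R"
      by (auto simp: nbhd_iff neighbours_def insert_commute)
    then have "card (nbhd G (J - ?U)) \<le> card (nbhd G J - R)" using finN by (intro card_mono) auto
    moreover have "card (nbhd G J - R) + card R = card (nbhd G J)"
      using finN R by (metis add.commute card_Int_Diff inf.absorb_iff2)
    moreover have "card (J - ?U) + card ?U = card J"
      using finJ U by (metis add.commute card_Int_Diff inf.absorb_iff2)
    ultimately show "card R \<le> card ?U" unfolding difference_def by linarith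
  qed
  then obtain f where f: "inj_on f (nbhd G J)" "\<And>v. v \<in> nbhd G J \<Longrightarrow> f v \<in> ?F v" by blast
  show ?thesis using that[OF f(1)] f(2) by (auto simp: neighbours_def insert_commute)
qed

text \<open>A matching \<open>f\<close> of \<open>N(J)\<close> into \<open>J\<close> pushes an independent set \<open>S\<close> of the closure
  \<open>J \<union> N(J)\<close> into \<open>J\<close> injectively: a collision between \<open>S \<inter> J\<close> and an image \<open>f v\<close> would put the
  edge \<open>{v, f v}\<close> inside \<open>S\<close>.\<close>

lemma inj_on_matched_into:
  assumes G: "simple_graph G" and S: "independent G S" "S \<subseteq> J \<union> nbhd G J"
    and f: "inj_on f (nbhd G J)" "\<And>v. v \<in> nbhd G J \<Longrightarrow> f v \<in> J"
    "\<And>v. v \<in> nbhd G J \<Longrightarrow> {v, f v} \<in> edges G"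
  shows "inj_on (\<lambda>v. if v \<in> J then v else f v) S"
proof -
  have "f v \<notin> S" if "v \<in> S" "v \<notin> J" for v
    using that S f(3)[of v] independent_edge[OF G S(1), of v "f v"] by auto
  moreover have "v \<in> nbhd G J" if "v \<in> S" "v \<notin> J" for v using S(2) that by blast
  ultimately show ?thesis
    using inj_onD[OF f(1)] by (intro inj_onI) (metis (full_types))
qed

lemma card_indep_within_critical:
  assumes G: "simple_graph G" and J: "critical_indep G J"
    and S: "independent G S" "S \<subseteq> J \<union> nbhd G J"
  shows "card S \<le> card J"
proof -
  obtain f where f: "inj_on f (nbhd G J)" "\<And>v. v \<in> nbhd G J \<Longrightarrow> f v \<in> J"
    "\<And>v. v \<in> nbhd G J \<Longrightarrow> {v, f v} \<in> edges G"
    using critical_matching[OF G J] by blast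
  have "finite J" using J independent_finite[OF G] by (simp add: critical_indep_def)
  let ?g = "\<lambda>v. if v \<in> J then v else f v"
  have "inj_on ?g S" using inj_on_matched_into[OF G S(1,2) f] .
  moreover have "?g ` S \<subseteq> J" using S(2) f(2) by auto
  ultimately show ?thesis using \<open>finite J\<close> by (rule card_inj_on_le)
qed

text \<open>The injection of \<open>S\<close> into \<open>J\<close> is onto when the sizes agree. Its only arguments that can be mapped to
  \<open>f v\<close> are \<open>f v\<close> itself and \<open>v\<close>.\<close>

lemma indep_within_critical_partner:
  assumes G: "simple_graph G" and J: "critical_indep G J"
    and S: "independent G S" "S \<subseteq> J \<union> nbhd G J" "card S = card J"
    and f: "inj_on f (nbhd G J)" "\<And>v. v \<in> nbhd G J \<Longrightarrow> f v \<in> J"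
    "\<And>v. v \<in> nbhd G J \<Longrightarrow> {v, f v} \<in> edges G"
    and v: "v \<in> nbhd G J"
  shows "v \<in> S \<or> f v \<in> S"
proof -
  have JI: "independent G J" using J by (simp add: critical_indep_def)
  have finJ: "finite J" using independent_finite[OF G JI] .
  let ?g = "\<lambda>v. if v \<in> J then v else f v"
  have "inj_on ?g S" using inj_on_matched_into[OF G S(1,2) f] .
  then have "card (?g ` S) = card J" using S(3) card_image by metis
  moreover have "?g ` S \<subseteq> J" using S(2) f(2) by auto
  ultimately have "?g ` S = J" using finJ by (simp add: card_subset_eq)
  then have "f v \<in> ?g ` S" using f(2)[OF v] by simp
  then obtain s where s: "s \<in> S" "?g s = f v" by auto
  show ?thesis
  proof (cases "s \<in> J")
    case False
    then have "s \<in> nbhd G J" "f s = f v" using s S(2) by auto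
    then show ?thesis using s(1) inj_onD[OF f(1)] v by blast
  qed (use s in auto)
qed

text \<open>Otherwise \<open>J \<union> I\<close> would be independent with a difference at least that of \<open>J\<close>,
  contradicting the maximum size of \<open>J\<close> among critical sets.\<close>

lemma indep_expands_outside_critical:
  assumes G: "simple_graph G" and J: "max_critical_indep G J"
    and I: "independent G I" "I \<inter> (J \<union> nbhd G J) = {}" "I \<noteq> {}"
  shows "card I < card (nbhd G I - (J \<union> nbhd G J))"
proof (rule ccontr)
  assume neg: "\<not> ?thesis"
  have finV: "finite (verts G)" using G by (simp add: simple_graph_def)
  have JC: "critical_indep G J" using J by (simp add: max_critical_indep_def)
  then have JI: "independent G J" by (simp add: critical_indep_def)
  have fin: "finite J" "finite I" "finite (nbhd G J)" "finite (nbhd G I)"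
    using independent_finite[OF G] JI I(1) finV nbhd_subset_verts[OF G] finite_subset by blast+
  have "independent G (J \<union> I)"
    using I(2) by (intro independent_Un JI I(1)) auto
  moreover have cJI: "card (J \<union> I) = card J + card I"
    using fin I(2) by (intro card_Un_disjoint) auto
  moreover have "nbhd G I \<inter> J = {}"
    using I(2) nbhdI[of _ J] by (fastforce simp: nbhd_iff)
  then have "nbhd G (J \<union> I) = nbhd G J \<union> (nbhd G I - (J \<union> nbhd G J))"
    by (auto simp: nbhd_def)
  then have "card (nbhd G (J \<union> I)) \<le> card (nbhd G J) + card (nbhd G I - (J \<union> nbhd G J))"
    by (metis card_Un_le)
  then have "difference G J \<le> difference G (J \<union> I)"
    unfolding difference_def cJI using neg by linarith
  ultimately have "critical_indep G (J \<union> I)"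
    using JC unfolding critical_indep_def by (meson dual_order.trans)
  then have "card (J \<union> I) \<le> card J" using J unfolding max_critical_indep_def by blast
  then show False using cJI I(3) fin(2) by simp
qed

text \<open>By supermodularity \<open>J \<union> J'\<close> still has maximum difference. Compare it with \<open>J\<close> alone.
  The new vertices are \<open>J' - L\<close> and \<open>J' \<inter> N(J)\<close>, and the new neighbours are \<open>N(J') - L\<close> and
  \<open>N(J') \<inter> J\<close>. The matching of \<open>N(J)\<close> into \<open>J\<close> shows that \<open>J' \<inter> N(J)\<close> is paid for by
  \<open>N(J') \<inter> J\<close>, so \<open>N(J') - L\<close> is no larger than \<open>J' - L\<close>. By the expansion property outside \<open>L\<close>,
  both are empty.\<close>

lemma max_critical_closure_subset:
  assumes G: "simple_graph G" and J: "max_critical_indep G J" and J': "max_critical_indep G J'"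
  shows "J' \<union> nbhd G J' \<subseteq> J \<union> nbhd G J"
proof -
  let ?L = "J \<union> nbhd G J"
  have finV: "finite (verts G)" using G by (simp add: simple_graph_def)
  have JC: "critical_indep G J" "critical_indep G J'"
    using J J' by (simp_all add: max_critical_indep_def)
  then have JI: "independent G J" "independent G J'" by (simp_all add: critical_indep_def)
  then have JV: "J \<union> J' \<subseteq> verts G" by (simp add: independent_def)
  have fin: "finite J" "finite J'" "finite (nbhd G J)" "finite (nbhd G J')"
    using independent_finite[OF G] JI finV nbhd_subset_verts[OF G] finite_subset by blast+
  obtain f where f: "inj_on f (nbhd G J)" "\<And>v. v \<in> nbhd G J \<Longrightarrow> f v \<in> J"
    "\<And>v. v \<in> nbhd G J \<Longrightarrow> {v, f v} \<in> edges G"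
    using critical_matching[OF G JC(1)] by blast
  have disj: "J \<inter> nbhd G J = {}" using independent_nbhd_disjoint[OF G JI(1)] by blast
  have dJ': "difference G J' = difference G J"
    using JC unfolding critical_indep_def by (simp add: dual_order.antisym)
  \<comment> \<open>Supermodularity, where the intersection contributes at most the maximum difference.\<close>
  have sup: "difference G J \<le> difference G (J \<union> J')"
  proof -
    have "difference G (J \<inter> J') \<le> difference G J"
      using JV by (intro difference_le_critical[OF G JC(1)]) auto
    moreover have "card (J \<union> J') + card (J \<inter> J') = card J + card J'"
      using fin by (intro card_Un_Int[symmetric])
    moreover have "nbhd G (J \<union> J') = nbhd G J \<union> nbhd G J'" by (auto simp: nbhd_def)
    then have "card (nbhd G (J \<union> J')) + card (nbhd G J \<inter> nbhd G J')
        = card (nbhd G J) + card (nbhd G J')"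
      using card_Un_Int[OF fin(3,4)] by simp
    moreover have "nbhd G (J \<inter> J') \<subseteq> nbhd G J \<inter> nbhd G J'" by (auto simp: nbhd_def)
    then have "card (nbhd G (J \<inter> J')) \<le> card (nbhd G J \<inter> nbhd G J')"
      using fin by (intro card_mono) auto
    ultimately show ?thesis using dJ' unfolding difference_def by linarith
  qed
  have matched: "card (J' \<inter> nbhd G J) \<le> card (nbhd G J' \<inter> J)"
  proof (rule card_inj_on_le)
    show "inj_on f (J' \<inter> nbhd G J)" using f(1) by (rule inj_on_subset) simp
    show "f ` (J' \<inter> nbhd G J) \<subseteq> nbhd G J' \<inter> J"
      using f(2,3) nbhdI[of _ J'] by fastforce
    show "finite (nbhd G J' \<inter> J)" using fin by simp
  qed
  have "card (J \<union> J') = card J + (card (J' - ?L) + card (J' \<inter> nbhd G J))"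
  proof -
    have "card ((J' - ?L) \<union> (J' \<inter> nbhd G J)) = card (J' - ?L) + card (J' \<inter> nbhd G J)"
      using fin by (intro card_Un_disjoint) auto
    moreover have "J \<union> J' = J \<union> ((J' - ?L) \<union> (J' \<inter> nbhd G J))" by auto
    moreover have "card (J \<union> ((J' - ?L) \<union> (J' \<inter> nbhd G J)))
        = card J + card ((J' - ?L) \<union> (J' \<inter> nbhd G J))"
      using fin disj by (intro card_Un_disjoint) auto
    ultimately show ?thesis by simp
  qed
  moreover have "card (nbhd G (J \<union> J'))
      = card (nbhd G J) + (card (nbhd G J' - ?L) + card (nbhd G J' \<inter> J))"
  proof -
    have "card ((nbhd G J' - ?L) \<union> (nbhd G J' \<inter> J)) = card (nbhd G J' - ?L) + card (nbhd G J' \<inter> J)"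
      using fin by (intro card_Un_disjoint) auto
    moreover have "nbhd G (J \<union> J') = nbhd G J \<union> ((nbhd G J' - ?L) \<union> (nbhd G J' \<inter> J))"
      by (auto simp: nbhd_iff)
    moreover have "card (nbhd G J \<union> ((nbhd G J' - ?L) \<union> (nbhd G J' \<inter> J)))
        = card (nbhd G J) + card ((nbhd G J' - ?L) \<union> (nbhd G J' \<inter> J))"
      using fin disj by (intro card_Un_disjoint) auto
    ultimately show ?thesis by simp
  qed
  ultimately have le: "card (nbhd G J' - ?L) \<le> card (J' - ?L)"
    using sup matched unfolding difference_def by linarith
  have out: "J' - ?L = {}"
  proof (rule ccontr)
    assume ne: "J' - ?L \<noteq> {}"
    have "independent G (J' - ?L)" using independent_subset[OF JI(2)] by blast
    then have "card (J' - ?L) < card (nbhd G (J' - ?L) - ?L)"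
      using ne by (intro indep_expands_outside_critical[OF G J]) auto
    also have "\<dots> \<le> card (nbhd G J' - ?L)"
      using fin by (intro card_mono) (auto simp: nbhd_def)
    finally show False using le by simp
  qed
  then have "nbhd G J' - ?L = {}" using le fin by (metis card.empty card_0_eq finite_Diff le_zero_eq)
  then show ?thesis using out by blast
qed

text \<open>The matching of \<open>N(J)\<close> into \<open>J\<close> bounds the part of an independent set within \<open>L\<close> by \<open>|J|\<close>.
  Conversely, no vertex outside \<open>L\<close> is adjacent to \<open>J\<close>, so \<open>J\<close> extends any independent set found
  there.\<close>

lemma indep_num_critical_split:
  assumes G: "simple_graph G" and J: "critical_indep G J"
  defines "L \<equiv> J \<union> nbhd G J"
  shows "indep_num (induced G L) = card J"
    and "indep_num G = card J + indep_num (induced G (verts G - L))"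
    and "\<And>T. independent (induced G (verts G - L)) T \<Longrightarrow> independent G (J \<union> T) \<and> card (J \<union> T) = card J + card T"
proof -
  have JI: "independent G J" using J by (simp add: critical_indep_def)
  have LV: "L \<subseteq> verts G"
    using JI nbhd_subset_verts[OF G] by (auto simp: L_def independent_def)
  have finJ: "finite J" using independent_finite[OF G JI] .
  let ?H = "induced G (verts G - L)"
  have H: "simple_graph ?H" using simple_graph_induced[OF G] by simp
  show "indep_num (induced G L) = card J"
  proof (rule indep_num_eqI[OF simple_graph_induced[OF G LV]])
    show "independent (induced G L) J"
      using JI independent_induced_iff[OF LV] by (simp add: L_def)
    show "card T \<le> card J" if "independent (induced G L) T" for T
      using that card_indep_within_critical[OF G J] independent_induced_iff[OF LV]
      by (simp add: L_def)
  qed simp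
  show ext: "independent G (J \<union> T) \<and> card (J \<union> T) = card J + card T" if "independent ?H T" for T
  proof
    have T: "independent G T" "T \<subseteq> verts G - L"
      using that independent_induced_iff[of "verts G - L" G T] by auto
    then show "independent G (J \<union> T)"
      by (intro independent_Un JI) (auto simp: L_def)
    show "card (J \<union> T) = card J + card T"
      using T finJ independent_finite[OF G T(1)] by (intro card_Un_disjoint) (auto simp: L_def)
  qed
  obtain T where T: "independent ?H T" "card T = indep_num ?H" using max_indep_exists[OF H] .
  show "indep_num G = card J + indep_num ?H"
  proof (rule indep_num_eqI[OF G])
    show "independent G (J \<union> T)" "card (J \<union> T) = card J + indep_num ?H"
      using ext[OF T(1)] T(2) by auto
    fix S assume S: "independent G S"
    have "card (S \<inter> L) \<le> card J"
      using card_indep_within_critical[OF G J independent_subset[OF S]] by (simp add: L_def)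
    moreover have "independent ?H (S - L)"
      using S independent_subset[OF S, of "S - L"] independent_induced_iff[of "verts G - L" G "S - L"]
      by (auto simp: independent_def)
    then have "card (S - L) \<le> indep_num ?H" by (rule indep_num_ge[OF H])
    moreover have "card S = card (S \<inter> L) + card (S - L)"
      using independent_finite[OF G S] by (metis card_Int_Diff)
    ultimately show "card S \<le> card J + indep_num ?H" by linarith
  qed
qed

text \<open>The matching of \<open>N(J)\<close> into \<open>J\<close> is maximum, since the independence of \<open>J\<close> makes \<open>N(J)\<close> a
  vertex cover of the subgraph induced by the closure.\<close>

lemma koenig_egervary_critical_closure:
  assumes G: "simple_graph G" and J: "critical_indep G J"
  shows "koenig_egervary (induced G (J \<union> nbhd G J))"
proof -
  let ?L = "J \<union> nbhd G J"
  have finV: "finite (verts G)" using G by (simp add: simple_graph_def)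
  have JI: "independent G J" using J by (simp add: critical_indep_def)
  have fin: "finite J" "finite (nbhd G J)"
    using independent_finite[OF G JI] finV nbhd_subset_verts[OF G] finite_subset by blast+
  have disj: "J \<inter> nbhd G J = {}" using independent_nbhd_disjoint[OF G JI] by blast
  obtain f where f: "inj_on f (nbhd G J)" "\<And>v. v \<in> nbhd G J \<Longrightarrow> f v \<in> J"
    "\<And>v. v \<in> nbhd G J \<Longrightarrow> {v, f v} \<in> edges G"
    using critical_matching[OF G J] by blast
  let ?M = "(\<lambda>v. {v, f v}) ` nbhd G J"
  have "matching_num (induced G ?L) = card (nbhd G J)"
  proof (rule matching_num_eqI)
    have "pairwise disjnt ?M"
      using f(1,2) disj by (auto simp: pairwise_def disjnt_def inj_on_def)
    then show "matching (induced G ?L) ?M"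
      unfolding matching_def induced_def using f by auto
    have "inj_on (\<lambda>v. {v, f v}) (nbhd G J)"
      using f(2) disj by (auto simp: inj_on_def doubleton_eq_iff)
    then show "card ?M = card (nbhd G J)" by (rule card_image)
    fix N assume N: "matching (induced G ?L) N"
    have "\<exists>v. v \<in> e \<inter> nbhd G J" if "e \<in> N" for e
    proof -
      have "e \<in> edges G" "e \<subseteq> ?L" using that N unfolding matching_def induced_def by auto
      moreover from this have "\<not> e \<subseteq> J" using JI independent_iff[OF G, of J] by simp
      ultimately show ?thesis by blast
    qed
    then show "card N \<le> card (nbhd G J)"
      using N fin(2) by (intro card_le_transversal) (auto simp: matching_def)
  qed
  moreover have "card ?L = card J + card (nbhd G J)" using fin disj by (rule card_Un_disjoint)
  ultimately show ?thesis
    using indep_num_critical_split(1)[OF G J] by (simp add: koenig_egervary_def induced_def)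
qed

text \<open>This is the existence half of Larson's theorem. It is needed because \<open>larson_set\<close> is a definite
  description, which says nothing unless some set satisfies it.\<close>

theorem larson_decomposition_critical_closure:
  assumes G: "simple_graph G" and J: "max_critical_indep G J"
  shows "larson_decomposition G (J \<union> nbhd G J)"
proof -
  let ?L = "J \<union> nbhd G J"
  have JC: "critical_indep G J" using J by (simp add: max_critical_indep_def)
  then have LV: "?L \<subseteq> verts G"
    using nbhd_subset_verts[OF G] by (auto simp: critical_indep_def independent_def)
  let ?H = "induced G (verts G - ?L)"
  have "card I < card (nbhd ?H I)" if I: "independent ?H I" "I \<noteq> {}" for I
  proof -
    have I': "independent G I" "I \<subseteq> verts G - ?L"
      using I(1) independent_induced_iff[of "verts G - ?L" G I] by auto
    have "nbhd ?H I = nbhd G I - ?L"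
      using I'(2) edge_verts[OF G] unfolding induced_def by (fastforce simp: nbhd_iff)
    then show ?thesis using indep_expands_outside_critical[OF G J I'(1)] I'(2) I(2) by auto
  qed
  moreover have "?L = J' \<union> nbhd G J'" if "max_critical_indep G J'" for J'
    using max_critical_closure_subset[OF G] that J by blast
  ultimately show ?thesis
    unfolding larson_decomposition_def
    using LV indep_num_critical_split[OF G JC] koenig_egervary_critical_closure[OF G JC] by simp
qed

corollary larson_set_eq:
  assumes G: "simple_graph G" and J: "max_critical_indep G J"
  shows "larson_set G = J \<union> nbhd G J"
proof -
  have "L = J \<union> nbhd G J" if "larson_decomposition G L" for L
    using that J unfolding larson_decomposition_def by blast
  then show ?thesis
    unfolding larson_set_def
    by (intro the_equality larson_decomposition_critical_closure[OF G J])
qed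

section \<open>The reduction to the complement of Larson's set\<close>

theorem corona_core_if_complement_covered:
  assumes G: "simple_graph G" and cov: "corona (larson_complement G) = verts (larson_complement G)"
  shows "corona G \<union> nbhd G (core G) = verts G"
proof
  show "corona G \<union> nbhd G (core G) \<subseteq> verts G"
    using nbhd_subset_verts[OF G] by (auto simp: corona_def max_indep_sets_def independent_def)
  obtain J where J: "max_critical_indep G J" using max_critical_indep_exists[OF G] by blast
  then have JC: "critical_indep G J" by (simp add: max_critical_indep_def)
  let ?L = "J \<union> nbhd G J"
  let ?H = "induced G (verts G - ?L)"
  have H: "larson_complement G = ?H"
    by (simp add: larson_complement_def larson_set_eq[OF G J])
  have sH: "simple_graph ?H" using simple_graph_induced[OF G] by simp
  have ext: "J \<union> T \<in> max_indep_sets G" if "T \<in> max_indep_sets ?H" for T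
    using that indep_num_critical_split(2,3)[OF G JC] by (simp add: max_indep_sets_def)
  obtain T where "T \<in> max_indep_sets ?H"
    using max_indep_exists[OF sH] by (auto simp: max_indep_sets_def)
  then have inJ: "J \<subseteq> corona G" using ext by (auto simp: corona_def)
  have inH: "verts G - ?L \<subseteq> corona G"
  proof
    fix v assume "v \<in> verts G - ?L"
    then have "v \<in> corona ?H" using cov H by (simp add: induced_def)
    then show "v \<in> corona G" using ext unfolding corona_def by blast
  qed
  obtain f where f: "inj_on f (nbhd G J)" "\<And>v. v \<in> nbhd G J \<Longrightarrow> f v \<in> J"
    "\<And>v. v \<in> nbhd G J \<Longrightarrow> {v, f v} \<in> edges G"
    using critical_matching[OF G JC] by blast
  have inN: "v \<in> corona G \<union> nbhd G (core G)" if v: "v \<in> nbhd G J" for v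
  proof (cases "f v \<in> core G")
    case True
    then show ?thesis using f(3)[OF v] by (auto simp: nbhd_iff)
  next
    case False
    then obtain S where S: "S \<in> max_indep_sets G" "f v \<notin> S" by (auto simp: core_def)
    then have SI: "independent G S" "card S = card J + indep_num ?H"
      using indep_num_critical_split(2)[OF G JC] by (auto simp: max_indep_sets_def)
    have SL: "independent G (S \<inter> ?L)" using independent_subset[OF SI(1)] by blast
    have "independent ?H (S - ?L)"
      using SI(1) independent_subset[OF SI(1), of "S - ?L"]
        independent_induced_iff[of "verts G - ?L" G "S - ?L"]
      by (auto simp: independent_def)
    then have "card (S - ?L) \<le> indep_num ?H" by (rule indep_num_ge[OF sH])
    moreover have "card S = card (S \<inter> ?L) + card (S - ?L)"
      using independent_finite[OF G SI(1)] by (metis card_Int_Diff)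
    moreover have "card (S \<inter> ?L) \<le> card J"
      using card_indep_within_critical[OF G JC SL] by simp
    ultimately have "card (S \<inter> ?L) = card J" using SI(2) by linarith
    \<comment> \<open>The set \<open>S \<inter> L\<close> has full size, so it meets the pair \<open>{v, f v}\<close>, and \<open>f v\<close> is not in it.\<close>
    then have "v \<in> S"
      using indep_within_critical_partner[OF G JC SL _ _ f v] S(2) by auto
    then show ?thesis using S(1) by (auto simp: corona_def)
  qed
  show "verts G \<subseteq> corona G \<union> nbhd G (core G)" using inJ inH inN by blast
qed

section \<open>Ears and perfect matchings\<close>

text \<open>Every other edge of a path with an even number of vertices gives a perfect matching of it.
  It serves for the interior of an odd ear, and for an even ear without one of its ends.\<close>

lemma even_list_pairing:
  assumes "distinct q" "even (length q)"
  shows "\<exists>N \<subseteq> path_edges q. pairwise disjnt N \<and> \<Union>N = set q \<and> card N = length q div 2"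
  using assms
proof (induction q rule: induct_list012)
  case 1
  then show ?case by (intro exI[of _ "{}"]) simp
next
  case (2 x)
  then show ?case by simp
next
  case (3 x y zs)
  then obtain N where N: "N \<subseteq> path_edges zs" "pairwise disjnt N" "\<Union>N = set zs"
    "card N = length zs div 2" by auto
  have "finite N" using N(3) finite_UnionD by (metis List.finite_set)
  have "path_edges zs \<subseteq> path_edges (x # y # zs)"
  proof
    fix e assume "e \<in> path_edges zs"
    then obtain i where "e = {zs ! i, zs ! Suc i}" "Suc i < length zs" by (auto simp: path_edges_def)
    then show "e \<in> path_edges (x # y # zs)"
      unfolding path_edges_def by (intro CollectI exI[of _ "i + 2"]) auto
  qed
  moreover have "{x, y} \<in> path_edges (x # y # zs)"
    unfolding path_edges_def by (intro CollectI exI[of _ 0]) auto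
  moreover have "\<forall>e\<in>N. disjnt {x, y} e" using 3 N(3) by (auto simp: disjnt_def)
  moreover from this have "{x, y} \<notin> N" by (auto simp: disjnt_def)
  ultimately show ?case
    using N \<open>finite N\<close>
    by (intro exI[of _ "insert {x, y} N"]) (auto simp: pairwise_insert disjnt_sym)
qed

lemma path_edges_tl: "path_edges (tl q) \<subseteq> path_edges q"
proof
  fix e assume "e \<in> path_edges (tl q)"
  then obtain i where "e = {tl q ! i, tl q ! Suc i}" "Suc i < length (tl q)"
    by (auto simp: path_edges_def)
  then show "e \<in> path_edges q"
    unfolding path_edges_def by (intro CollectI exI[of _ "Suc i"]) (auto simp: nth_tl)
qed

lemma path_edges_butlast: "path_edges (butlast q) \<subseteq> path_edges q"
  unfolding path_edges_def by (auto simp: nth_butlast)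

definition has_perfect_matching_through :: "'a graph \<Rightarrow> 'a set \<Rightarrow> bool" where
  "has_perfect_matching_through G e \<longleftrightarrow> (\<exists>M. matching G M \<and> \<Union>M = verts G \<and> e \<in> M)"

text \<open>The interior of an odd ear has an even number of vertices, so it has a perfect matching of its
  own, and the old matching remains untouched. In particular the edge of the initial complete graph on two vertices is never discarded.\<close>

lemma perfect_matching_add_odd_ear:
  assumes "has_perfect_matching_through G e" "is_ear G p" "odd (path_length p)"
  shows "has_perfect_matching_through (add_ear G p) e"
proof -
  obtain M where M: "matching G M" "\<Union>M = verts G" "e \<in> M"
    using assms(1) by (auto simp: has_perfect_matching_through_def)
  let ?q = "butlast (tl p)"
  have len: "length p \<ge> 2" and d: "distinct p" and ends: "hd p \<in> verts G" "last p \<in> verts G"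
    and int: "set ?q \<inter> verts G = {}"
    using assms(2) by (auto simp: is_ear_def)
  have "even (length ?q)" using assms(3) len by (auto simp: path_length_def)
  then obtain N where N: "N \<subseteq> path_edges ?q" "pairwise disjnt N" "\<Union>N = set ?q"
    using even_list_pairing[of ?q] d by (auto simp: distinct_butlast distinct_tl)
  have "p = hd p # ?q @ [last p]"
  proof -
    have "tl p \<noteq> []" using len by (cases p) auto
    then have "?q @ [last p] = tl p" by (metis append_butlast_last_id last_tl)
    then show ?thesis using len by (cases p) auto
  qed
  then have "set p = set (hd p # ?q @ [last p])" by (rule arg_cong)
  then have "set p = insert (hd p) (insert (last p) (set ?q))" by auto
  then have "\<Union>(M \<union> N) = verts G \<union> set p" using M(2) N(3) ends by auto
  moreover have "disjnt a b" if "a \<in> M" "b \<in> N" for a b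
    using that M(2) N(3) int by (auto simp: disjnt_def)
  then have "pairwise disjnt (M \<union> N)"
    using M(1) N(2) unfolding matching_def pairwise_def by (metis Un_iff disjnt_sym)
  moreover have "M \<union> N \<subseteq> edges G \<union> path_edges p"
    using M(1) N(1) path_edges_butlast[of "tl p"] path_edges_tl[of p] unfolding matching_def by auto
  ultimately show ?thesis
    unfolding has_perfect_matching_through_def using M(3)
    by (intro exI[of _ "M \<union> N"]) (simp add: matching_def add_ear_def)
qed

section \<open>Maximum independent sets of almost-bipartite matching covered graphs\<close>

text \<open>Write \<open>P\<close> as \<open>P ! 0, \<dots>, P ! (2 * k)\<close>. The ends are \<open>x\<close> and \<open>y\<close> in some order; the
  argument is symmetric in them, so the order is never fixed. The independence number is \<open>a\<close>
  below: one vertex from each edge of the matching other than \<open>{x, y}\<close>, and \<open>k\<close> vertices from the odd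
  cycle formed by \<open>P\<close> and \<open>{x, y}\<close>.\<close>

theorem corona_bipartite_even_ear:
  assumes simple: "simple_graph (add_ear K P)"
    and bip: "bipartite K"
    and pm: "has_perfect_matching_through K {x, y}"
    and ear: "is_ear K P" "even (path_length P)" "set P \<inter> verts K = {x, y}"
  shows "corona (add_ear K P) = verts (add_ear K P)"
proof
  let ?H = "add_ear K P"
  show "corona ?H \<subseteq> verts ?H" by (auto simp: corona_def max_indep_sets_def independent_def)
  obtain A B where AB: "A \<union> B = verts K" "A \<inter> B = {}"
    "\<forall>e\<in>edges K. \<exists>a\<in>A. \<exists>b\<in>B. e = {a, b}"
    using bip by (auto simp: bipartite_def)
  obtain M where M: "matching K M" "\<Union>M = verts K" "{x, y} \<in> M"
    using pm by (auto simp: has_perfect_matching_through_def)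
  have finK: "finite (verts K)" using simple by (simp add: simple_graph_def add_ear_def)
  have finM: "finite M" using M(2) finK finite_UnionD by metis
  have disjM: "pairwise disjnt M" and MK: "M \<subseteq> edges K" using M(1) by (auto simp: matching_def)
  obtain k where k: "length P = 2 * k + 1" "k \<ge> 1"
  proof -
    have "length P \<ge> 2" "odd (length P)" using ear(1,2) by (auto simp: is_ear_def path_length_def)
    then show ?thesis using that by (elim oddE) auto
  qed
  have dP: "distinct P" using ear(1) by (simp add: is_ear_def)
  have Pne: "P \<noteq> []" using k by auto
  have hl: "hd P = P ! 0" "last P = P ! (2 * k)"
    using Pne k by (simp_all add: hd_conv_nth last_conv_nth)
  have hl_ne: "hd P \<noteq> last P" using hl k dP by (simp add: nth_eq_iff_index_eq)
  have xy: "{hd P, last P} = {x, y}"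
  proof -
    have "hd P \<in> {x, y}" "last P \<in> {x, y}"
      unfolding ear(3)[symmetric] using ear(1) Pne by (auto simp: is_ear_def)
    then show ?thesis using hl_ne by auto
  qed
  have P_in_K: "i = 0 \<or> i = 2 * k" if "i \<le> 2 * k" "P ! i \<in> verts K" for i
  proof -
    have "P ! i \<in> {hd P, last P}" unfolding xy ear(3)[symmetric] using that k by auto
    then show ?thesis using hl that(1) k dP by (auto simp: nth_eq_iff_index_eq)
  qed
  define M' where "M' = M - {{x, y}}"
  define a where "a = card M' + k"
  have cM: "card M = Suc (card M')" using M(3) finM unfolding M'_def by (metis card.remove)
  have "disjnt e {x, y}" if "e \<in> M'" for e
    using pairwiseD[OF disjM _ M(3), of e] that by (auto simp: M'_def)
  then have M'_disj: "\<Union>M' \<inter> {x, y} = {}" by (auto simp: disjnt_def)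
  have "insert {x, y} M' = M" using M(3) by (auto simp: M'_def)
  then have M'_cov: "\<Union>M' \<union> {x, y} = verts K" using M(2) by (metis Union_insert Un_commute)
  \<comment> \<open>An independent set misses one end of the path. The remaining \<open>2 * k\<close> path vertices are paired up by path edges.\<close>
  have upper: "card S \<le> a" if S: "independent ?H S" for S
  proof -
    have no_edge: "\<not> e \<subseteq> S" if "e \<in> edges K \<union> path_edges P" for e
      using S that independent_iff[OF simple, of S] by (simp add: add_ear_def)
    have S_sub: "S \<subseteq> verts K \<union> set P" using S by (simp add: independent_def add_ear_def)
    have "\<not> {hd P, last P} \<subseteq> S" unfolding xy using no_edge M(3) MK by blast
    then have "S \<inter> set P \<subseteq> set (tl P) \<or> S \<inter> set P \<subseteq> set (butlast P)"
    proof -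
      have "set P = insert (hd P) (set (tl P))" using Pne by (cases P) auto
      moreover have "set P = insert (last P) (set (butlast P))"
        using append_butlast_last_id[OF Pne] set_append[of "butlast P" "[last P]"] by simp
      moreover have "hd P \<notin> S \<or> last P \<notin> S" using \<open>\<not> {hd P, last P} \<subseteq> S\<close> by auto
      ultimately show ?thesis by (metis Int_insert_right_if0 Int_lower2)
    qed
    then obtain q where q: "S \<inter> set P \<subseteq> set q" "q = tl P \<or> q = butlast P" by blast
    have qP: "distinct q" "length q = 2 * k" "set q \<subseteq> set P" "path_edges q \<subseteq> path_edges P"
      using q(2) dP k path_edges_tl[of P] path_edges_butlast[of P] list.set_sel(2)[OF Pne]
      by (auto simp: distinct_tl distinct_butlast dest: in_set_butlastD)
    then obtain N where N: "N \<subseteq> path_edges q" "pairwise disjnt N" "\<Union>N = set q" "card N = k"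
      using even_list_pairing[of q] by auto
    have finN: "finite N" using N(3) finite_UnionD by (metis List.finite_set)
    have "disjnt d e" if "d \<in> M'" "e \<in> N" for d e
    proof -
      have "d \<subseteq> verts K - {x, y}" using that(1) M'_disj M'_cov by auto
      moreover have "e \<subseteq> set P" using that(2) N(3) qP(3) by auto
      ultimately show ?thesis using ear(3) by (auto simp: disjnt_def)
    qed
    moreover have "pairwise disjnt M'" using disjM unfolding M'_def by (rule pairwise_subset) auto
    ultimately have "pairwise disjnt (M' \<union> N)"
      using N(2) unfolding pairwise_def by (metis Un_iff disjnt_sym)
    moreover have "S \<subseteq> \<Union>(M' \<union> N)"
    proof
      fix s assume s: "s \<in> S"
      show "s \<in> \<Union>(M' \<union> N)"
      proof (cases "s \<in> set P")
        case True
        then show ?thesis using s q(1) N(3) by auto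
      next
        case False
        then have "s \<in> verts K" "s \<notin> {x, y}" using s S_sub ear(3) by auto
        then show ?thesis using M'_cov by auto
      qed
    qed
    moreover have "\<exists>u v. e = {u, v} \<and> \<not> e \<subseteq> S" if e: "e \<in> M' \<union> N" for e
    proof -
      have e': "e \<in> edges ?H"
        using e MK N(1) qP(4) unfolding M'_def by (auto simp: add_ear_def)
      then have "\<not> e \<subseteq> S" using no_edge by (simp add: add_ear_def)
      then show ?thesis using edge_cases[OF simple e'] by blast
    qed
    ultimately have "card S \<le> card (M' \<union> N)"
      using finM finN unfolding M'_def by (intro card_le_if_no_pair_inside) auto
    also have "\<dots> \<le> a" using card_Un_le[of M' N] N(4) by (simp add: a_def)
    finally show ?thesis .
  qed
  \<comment> \<open>Interior path vertices of one parity are pairwise non-adjacent. The ends of the path have even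
    index, so their path neighbours have odd index; hence \<open>T\<close> has to avoid the ends in the odd case.\<close>
  have large: "T \<union> (!) P ` I \<subseteq> corona ?H"
    if T: "T \<subseteq> verts K" "\<And>e. e \<in> edges K \<Longrightarrow> \<not> e \<subseteq> T"
      and I: "I \<subseteq> {1..<2 * k}" "(\<forall>i\<in>I. even i) \<or> (\<forall>i\<in>I. odd i) \<and> T \<inter> {x, y} = {}"
      and c: "a \<le> card T + card I" for T I
  proof -
    let ?S = "T \<union> (!) P ` I"
    have int: "P ! i \<notin> verts K" if "i \<in> I" for i
      using P_in_K[of i] that I(1) by auto
    have mem_I: "i \<in> I" if i: "P ! i \<in> ?S" "P ! i \<notin> T" "i \<le> 2 * k" for i
    proof -
      obtain j where "j \<in> I" "P ! i = P ! j" using i(1,2) by auto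
      moreover have "j < length P" "i < length P" using \<open>j \<in> I\<close> I(1) i(3) k by auto
      ultimately show ?thesis using dP by (simp add: nth_eq_iff_index_eq)
    qed
    have "\<not> e \<subseteq> ?S" if e: "e \<in> edges ?H" for e
    proof (cases "e \<in> edges K")
      case True
      then have "e \<subseteq> verts K" using AB by auto
      then show ?thesis using T(2)[OF True] int by blast
    next
      case False
      then obtain i where i: "e = {P ! i, P ! Suc i}" "Suc i \<le> 2 * k"
        using e k by (auto simp: add_ear_def path_edges_def)
      show ?thesis
      proof
        assume sub: "e \<subseteq> ?S"
        have ends: "j = 0 \<or> j = 2 * k" "P ! j \<in> T \<inter> {x, y}" if "P ! j \<in> T" "j \<le> 2 * k" for j
        proof -
          show "j = 0 \<or> j = 2 * k" using P_in_K[of j] that T(1) by auto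
          then show "P ! j \<in> T \<inter> {x, y}" using that hl xy by auto
        qed
        consider "P ! i \<in> T" "P ! Suc i \<in> T" | "P ! i \<in> T" "Suc i \<in> I"
          | "i \<in> I" "P ! Suc i \<in> T" | "i \<in> I" "Suc i \<in> I"
          using sub i mem_I[of i] mem_I[of "Suc i"] by auto
        then show False
        proof cases
          case 1
          then show False using ends(1)[of i] ends(1)[of "Suc i"] i(2) by presburger
        next
          case 2
          then have "odd (Suc i)" using ends(1)[of i] i(2) by auto
          then show False using ends(2)[of i] I(2) 2 i(2) by auto
        next
          case 3
          then have "Suc i = 2 * k" using ends(1)[of "Suc i"] i(2) by auto
          then have "odd i" by presburger
          then show False using ends(2)[of "Suc i"] I(2) 3 i(2) by auto
        next
          case 4
          have "even (Suc i) \<noteq> even i" by simp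
          then show False using I(2) 4 by blast
        qed
      qed
    qed
    moreover have "?S \<subseteq> verts ?H" using T(1) I(1) k by (auto simp: add_ear_def)
    ultimately have ind: "independent ?H ?S" using independent_iff[OF simple] by simp
    have "card ?S = card T + card ((!) P ` I)"
      using T(1) int finK finite_subset[OF I(1)] by (intro card_Un_disjoint) (auto intro: finite_subset)
    also have "card ((!) P ` I) = card I"
      using dP I(1) k by (intro card_image inj_on_nth) auto
    finally have "a \<le> card ?S" using c by simp
    moreover have "card ?S \<le> a" using upper[OF ind] .
    ultimately have "card ?S = a" by simp
    then have "indep_num ?H = a" using indep_num_eqI[OF simple ind _ upper] by simp
    then have "?S \<in> max_indep_sets ?H" using ind \<open>card ?S = a\<close> by (simp add: max_indep_sets_def)
    then show ?thesis unfolding corona_def by blast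
  qed
  have hit: "e \<inter> C \<noteq> {}" "\<not> e \<subseteq> C" if C: "C = A \<or> C = B" and e: "e \<in> edges K" for C e
  proof -
    obtain u v where "u \<in> A" "v \<in> B" "e = {u, v}" using AB(3) e by blast
    then show "e \<inter> C \<noteq> {}" "\<not> e \<subseteq> C" using C AB(2) by auto
  qed
  \<comment> \<open>The indices \<open>0\<close> and \<open>2 * k\<close> are left out of \<open>?E\<close>, as they belong to the vertices \<open>x\<close> and \<open>y\<close> of \<open>K\<close>.\<close>
  let ?E = "(\<lambda>j. 2 * j) ` {1..<k}" and ?O = "(\<lambda>j. 2 * j + 1) ` {..<k}"
  have cE: "card ?E = k - 1" and cO: "card ?O = k"
    by (simp_all add: card_image inj_on_def)
  have even_sets: "C \<union> (!) P ` ?E \<subseteq> corona ?H" if C: "C = A \<or> C = B" for C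
  proof (rule large)
    show CK: "C \<subseteq> verts K" using C AB(1) by auto
    \<comment> \<open>Each colour class contains a vertex of every matching edge.\<close>
    have "card M \<le> card C"
      using CK finK disjM MK hit(1)[OF C] by (intro card_le_transversal) (auto intro: finite_subset)
    then show "a \<le> card C + card ?E" using cM cE k(2) by (simp add: a_def)
  qed (use hit(2)[OF C] in auto)
  have odd_set: "(A - {x, y}) \<union> (!) P ` ?O \<subseteq> corona ?H"
  proof (rule large)
    show "A - {x, y} \<subseteq> verts K" using AB(1) by auto
    show "\<not> e \<subseteq> A - {x, y}" if "e \<in> edges K" for e using hit(2)[of A e] that by auto
    have "pairwise disjnt M'" using disjM unfolding M'_def by (rule pairwise_subset) auto
    moreover have "e \<inter> (A - {x, y}) \<noteq> {}" if e: "e \<in> M'" for e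
    proof -
      have "e \<in> edges K" "e \<inter> {x, y} = {}" using e MK M'_disj by (auto simp: M'_def)
      then show ?thesis using hit(1)[of A e] by blast
    qed
    ultimately have "card M' \<le> card (A - {x, y})"
      using AB(1) finK by (intro card_le_transversal) (auto intro: finite_subset)
    then show "a \<le> card (A - {x, y}) + card ?O" using cO by (simp add: a_def)
  qed auto
  show "verts ?H \<subseteq> corona ?H"
  proof
    fix v assume "v \<in> verts ?H"
    then consider "v \<in> verts K" | "v \<in> set P" "v \<notin> verts K" by (auto simp: add_ear_def)
    then show "v \<in> corona ?H"
    proof cases
      case 1
      then show ?thesis using AB(1) even_sets by blast
    next
      case 2
      then obtain i where i: "v = P ! i" "i \<le> 2 * k"
        using k by (metis Suc_eq_plus1 in_set_conv_nth less_Suc_eq_le)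
      have "hd P \<in> verts K" "last P \<in> verts K" using ear(1) by (auto simp: is_ear_def)
      then have "i \<noteq> 0" "i \<noteq> 2 * k" using i(1) 2(2) hl by metis+
      then have i': "0 < i" "i < 2 * k" using i(2) by auto
      show ?thesis
      proof (cases "even i")
        case True
        then have "i \<in> ?E" using i' by (elim evenE) auto
        then show ?thesis using even_sets[of A] i(1) by blast
      next
        case False
        then have "i \<in> ?O" using i' by (elim oddE) auto
        then show ?thesis using odd_set i(1) by blast
      qed
    qed
  qed
qed

corollary corona_almost_bipartite_matching_covered:
  assumes "simple_graph H" "almost_bipartite_matching_covered H"
  shows "corona H = verts H"
proof -
  obtain r :: nat and Gs :: "nat \<Rightarrow> 'a graph" and P where r: "r \<ge> 1" and K2: "is_K2 (Gs 1)"
    and ears: "\<And>i. i \<in> {2..r} \<Longrightarrow>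
      \<exists>p. is_ear (Gs (i - 1)) p \<and> odd (path_length p) \<and> Gs i = add_ear (Gs (i - 1)) p"
    and bip: "bipartite (Gs r)"
    and P: "is_ear (Gs r) P" "even (path_length P)" "set P \<inter> verts (Gs r) = verts (Gs 1)"
    and H: "H = add_ear (Gs r) P"
    using assms(2) unfolding almost_bipartite_matching_covered_def by auto
  obtain x y where xy: "Gs 1 = Graph {x, y} {{x, y}}" using K2 by (auto simp: is_K2_def)
  have "has_perfect_matching_through (Gs r) {x, y}"
    using r ears
  proof (induction r rule: dec_induct)
    case base
    show ?case unfolding xy has_perfect_matching_through_def
      by (intro exI[of _ "{{x, y}}"]) (simp add: matching_def)
  next
    case (step n)
    obtain p where "is_ear (Gs n) p" "odd (path_length p)" "Gs (Suc n) = add_ear (Gs n) p"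
      using step.prems[of "Suc n"] step.hyps by auto
    moreover have "has_perfect_matching_through (Gs n) {x, y}"
      using step.IH step.prems by simp
    ultimately show ?case using perfect_matching_add_odd_ear by metis
  qed
  then show ?thesis
    using corona_bipartite_even_ear[of "Gs r" P x y] assms(1) bip P xy by (simp add: H)
qed

section \<open>Covering by the corona and the neighbours of the core\<close>

theorem theorem4p11:
  fixes G :: "'a graph"
  assumes "simple_graph G"
    and "almost_bipartite_matching_covered (larson_complement G)"
  shows "corona G \<union> nbhd G (core G) = verts G"
proof -
  have "simple_graph (larson_complement G)"
    unfolding larson_complement_def using assms(1) by (rule simple_graph_induced) simp
  then show ?thesis
    using corona_core_if_complement_covered[OF assms(1)]
      corona_almost_bipartite_matching_covered assms(2) by blast
qed

end
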